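(* Let $G$ be a basic CUH graph that omits $D$ and in which at least one of the two color classes is not an independent set. Then $\omega_R\in\{1,2,\aleph_0\}$. Moreover, if $\omega_R=\aleph_0$, then $\alpha_B=\aleph_0$, and for every blue vertex $b$ and every maximal red clique $M_R$ we have $|N(b)\cap M_R|=|M_R\setminus N(b)|=\aleph_0$.
   Context: All graphs are simple. A 2-colored graph is a graph with a map $\chi\colon V(G)\to\{\text{red},\text{blue}\}$; $R,B$ are the red and blue vertex sets; induced subgraphs inherit colors; isomorphisms are color-preserving. $G$ is ultrahomogeneous if every isomorphism between finite induced subgraphs extends to an automorphism. A CUH graph is a countably infinite ultrahomogeneous 2-colored graph in which $G[R]$ and $G[B]$ are disjoint unions of cliques; $\omega_R,\alpha_R$ are the clique number and independence number of $G[R]$, $\omega_B,\alpha_B$ those of $G[B]$ (values in $\mathbb{N}\cup\{\aleph_0\}$). $G$ is a blow-up if for one color $c$ (other color $c'$) there are a 2-colored graph $H$ whose $c$-colored vertices are independent and $i\in\mathbb{N}_{\ge2}\cup\{\aleph_0\}$ such that $G$ arises from $H$ by replacing each $c$-colored vertex $u$ by a $c$-colored $i$-clique whose vertices are adjacent exactly to the other vertices of the clique and to the $c'$-colored neighbors of $u$ in $H$. A CUH graph is basic if it is not a blow-up and $\min\{\alpha_R,\alpha_B\}\ge2$. $G$ omits a finite 2-colored graph $X$ if no induced subgraph of $G$ is isomorphic to $X$. $D$ is the 2-colored graph on red $r_1,r_2$ and blue $b_1,b_2$ with edges $r_1r_2,b_1b_2,r_1b_1,r_1b_2,r_2b_1$.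 *)

theory Defs
  imports
    "HOL-Library.Extended_Nat"
    "HOL-Library.Countable_Set"
    "HOL-Library.Disjoint_Sets"
begin

datatype color = Red | Blue

record 'a cgraph =
  verts :: "'a set"
  adj :: "'a \<Rightarrow> 'a \<Rightarrow> bool"
  col :: "'a \<Rightarrow> color"

definition simple_cgraph :: "'a cgraph \<Rightarrow> bool" where
  "simple_cgraph G \<longleftrightarrow>
     (\<forall>u v. adj G u v \<longrightarrow> u \<in> verts G \<and> v \<in> verts G \<and> u \<noteq> v \<and> adj G v u)"

definition color_class :: "color \<Rightarrow> 'a cgraph \<Rightarrow> 'a set" where
  "color_class c G = {v \<in> verts G. col G v = c}"

definition nbrs :: "'a cgraph \<Rightarrow> 'a \<Rightarrow> 'a set" where
  "nbrs G v = {u \<in> verts G. adj G v u}"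

definition induced :: "'a cgraph \<Rightarrow> 'a set \<Rightarrow> 'a cgraph" where
  "induced G S =
     \<lparr>verts = S, adj = (\<lambda>u v. u \<in> S \<and> v \<in> S \<and> adj G u v), col = col G\<rparr>"

definition is_iso :: "('a \<Rightarrow> 'b) \<Rightarrow> 'a cgraph \<Rightarrow> 'b cgraph \<Rightarrow> bool" where
  "is_iso f G H \<longleftrightarrow>
     bij_betw f (verts G) (verts H) \<and>
     (\<forall>v \<in> verts G. col H (f v) = col G v) \<and>
     (\<forall>u \<in> verts G. \<forall>v \<in> verts G. adj H (f u) (f v) \<longleftrightarrow> adj G u v)"

definition isomorphic :: "'a cgraph \<Rightarrow> 'b cgraph \<Rightarrow> bool" where
  "isomorphic G H \<longleftrightarrow> (\<exists>f. is_iso f G H)"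

definition ultrahomogeneous :: "'a cgraph \<Rightarrow> bool" where
  "ultrahomogeneous G \<longleftrightarrow>
     (\<forall>S T f. finite S \<and> finite T \<and> S \<subseteq> verts G \<and> T \<subseteq> verts G \<and>
        is_iso f (induced G S) (induced G T) \<longrightarrow>
        (\<exists>g. is_iso g G G \<and> (\<forall>v \<in> S. g v = f v)))"

definition union_of_cliques :: "'a cgraph \<Rightarrow> bool" where
  "union_of_cliques G \<longleftrightarrow>
     (\<exists>P. partition_on (verts G) P \<and>
        (\<forall>u \<in> verts G. \<forall>v \<in> verts G.
           adj G u v \<longleftrightarrow> u \<noteq> v \<and> (\<exists>C \<in> P. u \<in> C \<and> v \<in> C)))"

definition is_clique :: "'a cgraph \<Rightarrow> 'a set \<Rightarrow> bool" where
  "is_clique G K \<longleftrightarrow> K \<subseteq> verts G \<and> (\<forall>u \<in> K. \<forall>v \<in> K. u \<noteq> v \<longrightarrow> adj G u v)"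

definition indep_set :: "'a cgraph \<Rightarrow> 'a set \<Rightarrow> bool" where
  "indep_set G K \<longleftrightarrow> K \<subseteq> verts G \<and> (\<forall>u \<in> K. \<forall>v \<in> K. \<not> adj G u v)"

definition maximal_clique :: "'a cgraph \<Rightarrow> 'a set \<Rightarrow> bool" where
  "maximal_clique G K \<longleftrightarrow> is_clique G K \<and> (\<forall>L. is_clique G L \<and> K \<subseteq> L \<longrightarrow> L = K)"

text \<open>For subsets of a countable set, the value \<open>\<infinity>\<close> is the cardinality \<open>\<aleph>\<^sub>0\<close>.\<close>

definition ecard :: "'a set \<Rightarrow> enat" where
  "ecard A = (if finite A then enat (card A) else \<infinity>)"

definition clique_number :: "'a cgraph \<Rightarrow> enat" where
  "clique_number G = (SUP K \<in> {K. is_clique G K}. ecard K)"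

definition independence_number :: "'a cgraph \<Rightarrow> enat" where
  "independence_number G = (SUP K \<in> {K. indep_set G K}. ecard K)"

definition color_omega :: "color \<Rightarrow> 'a cgraph \<Rightarrow> enat" where
  "color_omega c G = clique_number (induced G (color_class c G))"

definition color_alpha :: "color \<Rightarrow> 'a cgraph \<Rightarrow> enat" where
  "color_alpha c G = independence_number (induced G (color_class c G))"

definition CUH :: "'a cgraph \<Rightarrow> bool" where
  "CUH G \<longleftrightarrow>
     simple_cgraph G \<and> countable (verts G) \<and> infinite (verts G) \<and>
     ultrahomogeneous G \<and>
     union_of_cliques (induced G (color_class Red G)) \<and>
     union_of_cliques (induced G (color_class Blue G))"

text \<open>The clique replacing a vertex \<open>u\<close> of color \<open>c\<close> consists of the pairs \<open>(u, k)\<close> with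
  \<open>k < i\<close>; a vertex \<open>u\<close> of the other color is represented by \<open>(u, 0)\<close>.\<close>

definition blow_up_graph :: "color \<Rightarrow> enat \<Rightarrow> 'a cgraph \<Rightarrow> ('a \<times> nat) cgraph" where
  "blow_up_graph c i H =
     (let V = {(u, k). u \<in> verts H \<and> (if col H u = c then enat k < i else k = 0)}
      in \<lparr>verts = V,
          adj = (\<lambda>x y. x \<in> V \<and> y \<in> V \<and>
                   (adj H (fst x) (fst y) \<or> fst x = fst y \<and> snd x \<noteq> snd y)),
          col = (\<lambda>x. col H (fst x))\<rparr>)"

text \<open>Taking \<open>H\<close> over the vertex type of \<open>G\<close> is no restriction, since \<open>G\<close> contains an
  isomorphic copy of \<open>H\<close> (one vertex from each of the cliques).\<close>

definition is_blow_up :: "'a cgraph \<Rightarrow> bool" where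
  "is_blow_up G \<longleftrightarrow>
     (\<exists>c i (H :: 'a cgraph).
        simple_cgraph H \<and> indep_set H (color_class c H) \<and> 2 \<le> i \<and>
        isomorphic G (blow_up_graph c i H))"

definition basic :: "'a cgraph \<Rightarrow> bool" where
  "basic G \<longleftrightarrow> \<not> is_blow_up G \<and> min (color_alpha Red G) (color_alpha Blue G) \<ge> 2"

definition omits :: "'a cgraph \<Rightarrow> 'b cgraph \<Rightarrow> bool" where
  "omits G X \<longleftrightarrow> \<not> (\<exists>S \<subseteq> verts G. isomorphic (induced G S) X)"

datatype D_vertex = D_r1 | D_r2 | D_b1 | D_b2

definition D_graph :: "D_vertex cgraph" where
  "D_graph =
     \<lparr>verts = UNIV,
      adj = (\<lambda>u v. {u, v} \<in>
               {{D_r1, D_r2}, {D_b1, D_b2}, {D_r1, D_b1}, {D_r1, D_b2}, {D_r2, D_b1}}),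
      col = (\<lambda>v. if v \<in> {D_r1, D_r2} then Red else Blue)\<rparr>"

end

theory Submission
  imports Defs
begin

text \<open>Call a maximal monochromatic clique a block. Each color class is the disjoint union of
  its blocks, and by ultrahomogeneity the blocks of one color have equal size. If all red cliques
  have at most two vertices, \<open>color_omega Red G\<close> is 1 or 2. Otherwise every red block
  has at least three vertices, and then every blue vertex has infinitely many neighbors and
  infinitely many non-neighbors in each red block, so that red blocks are infinite.

  To see this, note that \<open>G\<close> is not a blow-up, so some blue vertex separates two
  adjacent red vertices; homogeneity spreads this to every blue vertex and every red block
  (\<open>neighbor_and_non_neighbor_in_block\<close>). If a blue \<open>b\<close> had a finite trace
  on some red block, there would be a second blue vertex \<open>b'\<close> that agrees with
  \<open>b\<close> on this block but not on another one, while still agreeing there on a third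
  vertex. An automorphism that fixes \<open>b\<close> and \<open>b'\<close> and moves this vertex
  into the first block carries a disagreement to where there is none
  (\<open>infinite_trace_on_block\<close>).

  For the independence number, infinite traces and homogeneity realize any adjacency pattern on
  finitely many vertices of a red block by a blue vertex (\<open>ex_prescribed_trace\<close>).
  Omitting \<open>D\<close> forces the traces of two adjacent blue vertices on a red block to be
  equal as soon as they meet. Strictly nested nonempty traces therefore give arbitrarily large
  independent sets of blue vertices.\<close>

locale CUH_graph =
  fixes G :: "'a cgraph"
  assumes CUH: "CUH G"
begin

section \<open>Blocks: the maximal monochromatic cliques\<close>

definition block :: "'a \<Rightarrow> 'a set" where
  "block v = {u \<in> verts G. col G u = col G v \<and> (u = v \<or> adj G v u)}"

lemma adj_verts: "adj G u v \<Longrightarrow> u \<in> verts G \<and> v \<in> verts G"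
  and adj_neq: "adj G u v \<Longrightarrow> u \<noteq> v"
  and adj_sym: "adj G u v \<longleftrightarrow> adj G v u"
  using CUH unfolding CUH_def simple_cgraph_def by blast+

text \<open>The parts of the partition into cliques are disjoint, so the part holding
  \<open>u\<close> and \<open>v\<close> is the part holding \<open>v\<close> and \<open>w\<close>.
  This makes the blocks equivalence classes.\<close>

lemma adj_trans_same_color:
  assumes "adj G u v" "adj G v w" "col G u = col G v" "col G w = col G v" "u \<noteq> w"
  shows "adj G u w"
proof -
  let ?S = "color_class (col G v) G"
  have mem: "u \<in> ?S" "v \<in> ?S" "w \<in> ?S"
    using assms adj_verts by (auto simp: color_class_def)
  have "union_of_cliques (induced G ?S)"
    using CUH unfolding CUH_def by (cases "col G v") auto
  then obtain P where P: "partition_on ?S P"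
    and adj: "\<And>x y. x \<in> ?S \<Longrightarrow> y \<in> ?S \<Longrightarrow> adj G x y \<longleftrightarrow> x \<noteq> y \<and> (\<exists>C \<in> P. x \<in> C \<and> y \<in> C)"
    unfolding union_of_cliques_def induced_def by auto
  obtain C C' where C: "C \<in> P" "u \<in> C" "v \<in> C" "C' \<in> P" "v \<in> C'" "w \<in> C'"
    using adj[OF mem(1,2)] adj[OF mem(2,3)] assms by auto
  then have "C = C'"
    using partition_onD2[OF P] by (auto simp: disjoint_def)
  then show ?thesis
    using adj[OF mem(1,3)] C assms(5) by blast
qed

lemma self_mem_block: "v \<in> verts G \<Longrightarrow> v \<in> block v"
  by (simp add: block_def)

lemma block_subset: "block v \<subseteq> verts G"
  by (auto simp: block_def)

lemma col_block: "u \<in> block v \<Longrightarrow> col G u = col G v"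
  by (auto simp: block_def)

lemma block_eq:
  assumes "u \<in> block v"
  shows "block u = block v"
proof -
  have *: "x \<in> block z" if "x \<in> block y" "y \<in> block z" for x y z
    using that adj_trans_same_color[of z y x] unfolding block_def by auto
  have "v \<in> block u"
    using assms adj_sym adj_verts unfolding block_def by auto
  then show ?thesis
    using * assms by blast
qed

lemma adj_iff_block:
  assumes "u \<in> verts G" "v \<in> verts G" "col G u = col G v"
  shows "adj G u v \<longleftrightarrow> u \<noteq> v \<and> block u = block v"
proof
  assume "adj G u v"
  then show "u \<noteq> v \<and> block u = block v"
    using assms block_eq[of v u] adj_neq by (auto simp: block_def)
next
  assume "u \<noteq> v \<and> block u = block v"
  then show "adj G u v"
    using self_mem_block[OF assms(2)] by (auto simp: block_def)
qed

lemma adj_in_block: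
  assumes "u \<in> block r" "v \<in> block r" "u \<noteq> v"
  shows "adj G u v"
  using assms(2,3) block_eq[OF assms(1)] by (auto simp: block_def)

section \<open>Automorphisms and ultrahomogeneity\<close>

lemma automorphism:
  assumes "is_iso g G G"
  shows automorphism_inj: "inj_on g (verts G)"
    and automorphism_surj: "g ` verts G = verts G"
    and automorphism_verts: "v \<in> verts G \<Longrightarrow> g v \<in> verts G"
    and automorphism_col: "v \<in> verts G \<Longrightarrow> col G (g v) = col G v"
    and automorphism_adj: "u \<in> verts G \<Longrightarrow> v \<in> verts G \<Longrightarrow> adj G (g u) (g v) \<longleftrightarrow> adj G u v"
  using assms by (auto simp: is_iso_def bij_betw_def)

lemma automorphism_block:
  assumes g: "is_iso g G G" and v: "v \<in> verts G"
  shows "g ` block v = block (g v)"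
proof (intro equalityI subsetI)
  fix w assume w: "w \<in> block (g v)"
  then obtain u where u: "u \<in> verts G" "w = g u"
    using automorphism_surj[OF g] block_subset by blast
  then have "u \<in> block v"
    using w v inj_onD[OF automorphism_inj[OF g]] automorphism_col[OF g] automorphism_adj[OF g]
    by (auto simp: block_def)
  then show "w \<in> g ` block v"
    using u by blast
next
  fix w assume "w \<in> g ` block v"
  then show "w \<in> block (g v)"
    using v automorphism_verts[OF g] automorphism_col[OF g] automorphism_adj[OF g]
    by (auto simp: block_def)
qed

text \<open>Ultrahomogeneity in the form used below: the target subgraph is the one induced on the
  image of \<open>S\<close>, and since there are no loops, adjacency has to be compared on distinct
  vertices only.\<close>

lemma extend_to_automorphism:
  assumes "finite S" "S \<subseteq> verts G" "f ` S \<subseteq> verts G" "inj_on f S"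
    and "\<And>v. v \<in> S \<Longrightarrow> col G (f v) = col G v"
    and "\<And>u v. u \<in> S \<Longrightarrow> v \<in> S \<Longrightarrow> u \<noteq> v \<Longrightarrow> adj G (f u) (f v) \<longleftrightarrow> adj G u v"
  obtains g where "is_iso g G G" "\<And>v. v \<in> S \<Longrightarrow> g v = f v"
proof -
  have "adj G (f u) (f v) \<longleftrightarrow> adj G u v" if "u \<in> S" "v \<in> S" for u v
    using assms(6)[OF that] adj_neq by (cases "u = v") blast+
  then have "is_iso f (induced G S) (induced G (f ` S))"
    using assms by (auto simp: is_iso_def induced_def bij_betw_def)
  then show ?thesis
    using CUH assms that unfolding CUH_def ultrahomogeneous_def
    by (metis finite_imageI)
qed

text \<open>All distinct vertices of a block are adjacent and equally colored, so every injection
  between finite subsets of it is a partial isomorphism.\<close>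

lemma extend_block_injection:
  assumes "finite S" "S \<subseteq> block r" "f ` S \<subseteq> block r" "inj_on f S"
  obtains g where "is_iso g G G" "\<And>v. v \<in> S \<Longrightarrow> g v = f v"
proof (rule extend_to_automorphism[of S f])
  show "S \<subseteq> verts G" "f ` S \<subseteq> verts G"
    using assms block_subset by blast+
  show "col G (f v) = col G v" if "v \<in> S" for v
    using that assms col_block by (metis image_subset_iff subsetD)
  show "adj G (f u) (f v) \<longleftrightarrow> adj G u v" if "u \<in> S" "v \<in> S" "u \<noteq> v" for u v
  proof -
    have "u \<in> block r" "v \<in> block r" "f u \<in> block r" "f v \<in> block r" "f u \<noteq> f v"
      using that assms inj_onD[OF assms(4)] by blast+
    then show ?thesis
      using adj_in_block that(3) by blast
  qed
qed (use assms that in auto)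

lemma move_vertex:
  assumes "u \<in> verts G" "v \<in> verts G" "col G u = col G v"
  obtains g where "is_iso g G G" "g u = v"
proof (rule extend_to_automorphism[of "{u}" "\<lambda>_. v"])
qed (use assms that in auto)

lemma move_pair:
  assumes "u \<in> verts G" "v \<in> verts G" "col G u \<noteq> col G v"
    and "u' \<in> verts G" "v' \<in> verts G" "col G u' = col G u" "col G v' = col G v"
    and "adj G u v \<longleftrightarrow> adj G u' v'"
  obtains g where "is_iso g G G" "g u = u'" "g v = v'"
proof -
  have neq: "u \<noteq> v" "u' \<noteq> v'"
    using assms by auto
  obtain g where "is_iso g G G" "\<And>w. w \<in> {u, v} \<Longrightarrow> g w = (if w = u then u' else v')"
  proof (rule extend_to_automorphism[of "{u, v}" "\<lambda>w. if w = u then u' else v'"])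
  qed (use assms neq adj_sym in \<open>auto simp: inj_on_def split: if_splits\<close>)
  then show ?thesis
    using that neq by auto
qed

lemma block_equicardinal:
  assumes "u \<in> verts G" "v \<in> verts G" "col G u = col G v"
  shows "ecard (block u) = ecard (block v)"
proof -
  obtain g where g: "is_iso g G G" "g u = v"
    using move_vertex[OF assms] .
  have "g ` block u = block v"
    using automorphism_block[OF g(1) assms(1)] g(2) by simp
  moreover have "inj_on g (block u)"
    using inj_on_subset[OF automorphism_inj[OF g(1)] block_subset] .
  ultimately show ?thesis
    by (metis ecard_def card_image finite_image_iff)
qed

end

section \<open>Twins and blow-ups\<close>

lemma ecard_mono: "A \<subseteq> B \<Longrightarrow> ecard A \<le> ecard B"
  by (auto simp: ecard_def card_mono dest: finite_subset)

text \<open>Supplies the indices \<open>k < i\<close> that \<open>blow_up_graph\<close> attaches to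
  the vertices of a clique, for finite and infinite cliques alike.\<close>

lemma ex_bij_betw_enat_initial:
  assumes "countable A"
  shows "\<exists>e. bij_betw e A {k. enat k < ecard A}"
proof (cases "finite A")
  case True
  then show ?thesis
    using ex_bij_betw_finite_nat[OF True] by (simp add: ecard_def atLeast0LessThan lessThan_def)
next
  case False
  then show ?thesis
    using to_nat_on_infinite[OF assms False] by (auto simp: ecard_def)
qed

context CUH_graph
begin

text \<open>If adjacent vertices of color \<open>c\<close> cannot be told apart by the other color,
  adjacency across the colors depends only on the block. All blocks of color \<open>c\<close> have
  the same size \<open>i\<close>, which is at least 2 because of the edge \<open>u0 v0\<close>. So
  \<open>G\<close> is the blow-up of the subgraph on one representative per block together with all
  vertices of the other color.\<close>

lemma blow_up_if_twins:
  assumes pair: "adj G u0 v0" "col G u0 = c" "col G v0 = c"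
    and twins: "\<And>u v b. adj G u v \<Longrightarrow> col G u = c \<Longrightarrow> col G v = c \<Longrightarrow> b \<in> verts G \<Longrightarrow>
      col G b \<noteq> c \<Longrightarrow> adj G b u \<Longrightarrow> adj G b v"
  shows "is_blow_up G"
proof -
  define i where "i = ecard (block u0)"
  have i: "ecard (block v) = i" if "v \<in> verts G" "col G v = c" for v
    using block_equicardinal[of v u0] that pair adj_verts by (auto simp: i_def)
  have "{u0, v0} \<subseteq> block u0"
    using pair adj_verts by (auto simp: block_def)
  then have "2 \<le> i"
    using ecard_mono[of "{u0, v0}" "block u0"] adj_neq[OF pair(1)]
    by (auto simp: i_def ecard_def numeral_eq_enat split: if_splits)
  \<comment> \<open>The choice depends on \<open>v\<close> only through the set
    \<open>block v\<close>, so all vertices of one block of color \<open>c\<close> get the same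
    representative.\<close>
  define rep where "rep v = (if col G v = c then SOME w. w \<in> block v else v)" for v
  have rep_block: "rep v \<in> block v" if "v \<in> verts G" for v
    using self_mem_block[OF that] by (auto simp: rep_def intro: someI)
  have block_rep: "block (rep v) = block v" if "v \<in> verts G" for v
    using block_eq[OF rep_block[OF that]] .
  have rep_eq: "rep u = rep v \<longleftrightarrow> block u = block v"
    if "u \<in> verts G" "v \<in> verts G" "col G u = c" "col G v = c" for u v
  proof
    assume "rep u = rep v"
    then show "block u = block v"
      using block_rep that by metis
  next
    assume "block u = block v"
    then show "rep u = rep v"
      using that by (simp add: rep_def)
  qed
  have rep_adj: "adj G b (rep v) \<longleftrightarrow> adj G b v"
    if "v \<in> verts G" "b \<in> verts G" "col G v = c" "col G b \<noteq> c" for v b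
    using that twins[of v "rep v" b] twins[of "rep v" v b] rep_block[OF that(1)] adj_sym
    by (auto simp: block_def)
  define H where "H = induced G (rep ` verts G)"
  define e where "e w = (SOME e. bij_betw e (block w) {k. enat k < ecard (block w)})" for w
  have e: "bij_betw (e w) (block w) {k. enat k < ecard (block w)}" for w
  proof -
    have "countable (block w)"
      using CUH countable_subset[OF block_subset] by (auto simp: CUH_def)
    then show ?thesis
      unfolding e_def by (intro someI_ex[of "\<lambda>e. bij_betw e _ _"] ex_bij_betw_enat_initial)
  qed
  \<comment> \<open>The second component numbers the vertices within their block; the value 0 for
    the other color is the convention of \<open>blow_up_graph\<close>.\<close>
  define f where "f v = (rep v, if col G v = c then e (rep v) v else 0)" for v
  have rep_verts: "rep v \<in> verts G" and rep_col: "col G (rep v) = col G v" if "v \<in> verts G" for v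
    using rep_block[OF that] by (auto simp: block_def)
  have vertsB: "verts (blow_up_graph c i H) =
      {(w, k). w \<in> rep ` verts G \<and> (if col G w = c then enat k < i else k = 0)}"
    by (auto simp: blow_up_graph_def H_def induced_def)
  have f_mem: "f v \<in> verts (blow_up_graph c i H)" if "v \<in> verts G" for v
    using that bij_betwE[OF e[of "rep v"]] i[of "rep v"] rep_verts[OF that] rep_col[OF that]
      block_rep[OF that] self_mem_block[OF that]
    by (auto simp: vertsB f_def)
  have f_inj: "inj_on f (verts G)"
  proof (rule inj_onI)
    fix u v assume uv: "u \<in> verts G" "v \<in> verts G" "f u = f v"
    then have r: "rep u = rep v"
      by (simp add: f_def)
    then have cuv: "col G u = col G v"
      using rep_col uv by metis
    show "u = v"
    proof (cases "col G v = c")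
      case True
      then have "e (rep v) u = e (rep v) v"
        using uv(3) r cuv by (simp add: f_def)
      moreover have "u \<in> block (rep v)" "v \<in> block (rep v)"
        using self_mem_block block_rep uv r by metis+
      ultimately show ?thesis
        using bij_betw_imp_inj_on[OF e[of "rep v"]] by (auto dest: inj_onD)
    next
      case False
      then show ?thesis
        using r cuv by (simp add: rep_def)
    qed
  qed
  have f_surj: "verts (blow_up_graph c i H) \<subseteq> f ` verts G"
  proof
    fix x assume "x \<in> verts (blow_up_graph c i H)"
    then obtain v k where v: "v \<in> verts G" "x = (rep v, k)"
      and k: "if col G v = c then enat k < i else k = 0"
      using rep_col by (auto simp: vertsB)
    show "x \<in> f ` verts G"
    proof (cases "col G v = c")
      case True
      then have "k \<in> {k. enat k < ecard (block (rep v))}"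
        using k i[of "rep v"] rep_verts v rep_col by auto
      then obtain u where u: "u \<in> block (rep v)" "e (rep v) u = k"
        using bij_betw_imp_surj_on[OF e[of "rep v"]] by (metis imageE)
      then have "u \<in> block v"
        using block_rep[OF v(1)] by simp
      then have "u \<in> verts G" "col G u = c" "block u = block v"
        using block_eq col_block block_subset True by blast+
      then have "f u = x"
        using u v rep_eq[of u v] True by (simp add: f_def)
      then show ?thesis
        using \<open>u \<in> verts G\<close> by blast
    next
      case False
      then show ?thesis
        using v k by (auto simp: f_def image_iff intro!: bexI[of _ v])
    qed
  qed
  have f_adj: "adj (blow_up_graph c i H) (f u) (f v) \<longleftrightarrow> adj G u v"
    if uv: "u \<in> verts G" "v \<in> verts G" for u v
  proof -
    have *: "adj (blow_up_graph c i H) (f u) (f v) \<longleftrightarrow>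
        adj G (rep u) (rep v) \<or> rep u = rep v \<and> snd (f u) \<noteq> snd (f v)"
    proof -
      have "adj (blow_up_graph c i H) p q \<longleftrightarrow>
          p \<in> verts (blow_up_graph c i H) \<and> q \<in> verts (blow_up_graph c i H) \<and>
          (adj H (fst p) (fst q) \<or> fst p = fst q \<and> snd p \<noteq> snd q)" for p q
        by (simp add: blow_up_graph_def Let_def)
      moreover have "adj H (rep u) (rep v) \<longleftrightarrow> adj G (rep u) (rep v)"
        using uv by (simp add: H_def induced_def)
      moreover have "fst (f u) = rep u" "fst (f v) = rep v"
        by (simp_all add: f_def)
      ultimately show ?thesis
        using f_mem[OF uv(1)] f_mem[OF uv(2)] by simp
    qed
    show ?thesis
    proof (cases "col G u = c"; cases "col G v = c")
      assume c: "col G u = c" "col G v = c"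
      have "snd (f u) \<noteq> snd (f v) \<longleftrightarrow> u \<noteq> v" if "rep u = rep v"
      proof -
        have "fst (f u) = fst (f v)"
          using that by (simp add: f_def)
        then show ?thesis
          using inj_on_eq_iff[OF f_inj uv] by (metis prod_eqI)
      qed
      moreover have "\<not> adj G (rep u) (rep v)"
        using adj_iff_block[of "rep u" "rep v"] rep_verts rep_col block_rep rep_eq uv c
        by metis
      ultimately show ?thesis
        using * rep_eq[OF uv c] adj_iff_block[OF uv] c by auto
    next
      assume c: "col G u = c" "col G v \<noteq> c"
      then have "rep v = v"
        by (simp add: rep_def)
      moreover have "rep u \<noteq> rep v"
        using rep_col[OF uv(1)] rep_col[OF uv(2)] c by metis
      ultimately show ?thesis
        using * rep_adj[of u v] uv c adj_sym by metis
    next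
      assume c: "col G u \<noteq> c" "col G v = c"
      then have "rep u = u"
        by (simp add: rep_def)
      moreover have "rep u \<noteq> rep v"
        using rep_col[OF uv(1)] rep_col[OF uv(2)] c by metis
      ultimately show ?thesis
        using * rep_adj[of v u] uv c by metis
    next
      assume c: "col G u \<noteq> c" "col G v \<noteq> c"
      then show ?thesis
        using * by (auto simp: rep_def f_def)
    qed
  qed
  have "col (blow_up_graph c i H) (f v) = col G v" if "v \<in> verts G" for v
    using rep_col[OF that] by (simp add: blow_up_graph_def Let_def H_def induced_def f_def)
  moreover have "bij_betw f (verts G) (verts (blow_up_graph c i H))"
    using f_inj f_mem f_surj by (auto simp: bij_betw_def)
  ultimately have "is_iso f G (blow_up_graph c i H)"
    using f_adj by (simp add: is_iso_def)
  moreover have "simple_cgraph H"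
    using adj_neq adj_sym by (auto simp: simple_cgraph_def H_def induced_def)
  moreover have "indep_set H (color_class c H)"
  proof -
    have "\<not> adj G (rep u) (rep v)"
      if "u \<in> verts G" "v \<in> verts G" "col G (rep u) = c" "col G (rep v) = c" for u v
      using adj_iff_block[of "rep u" "rep v"] rep_verts rep_col block_rep rep_eq[of u v] that
      by metis
    then show ?thesis
      by (auto simp: indep_set_def color_class_def H_def induced_def)
  qed
  ultimately show ?thesis
    using \<open>2 \<le> i\<close> unfolding is_blow_up_def isomorphic_def by blast
qed

section \<open>Traces of a vertex on the blocks of the other color\<close>

text \<open>As \<open>G\<close> is not a blow-up, some vertex \<open>a\<close> of the other color
  has both a neighbor and a non-neighbor in some block of color \<open>c\<close>. Homogeneity
  transports \<open>a\<close> to \<open>b\<close> and this block to \<open>block r\<close>. The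
  Boolean \<open>P\<close> treats neighbors and non-neighbors at once.\<close>

lemma neighbor_and_non_neighbor_in_block:
  assumes "\<not> is_blow_up G" "adj G u0 v0" "col G u0 = c" "col G v0 = c"
    and r: "r \<in> verts G" "col G r = c" and b: "b \<in> verts G" "col G b \<noteq> c"
  shows "\<exists>u \<in> block r. adj G b u \<longleftrightarrow> P"
proof -
  obtain u v a where uv: "adj G u v" "col G u = c" "col G v = c"
    and a: "a \<in> verts G" "col G a \<noteq> c" "adj G a u" "\<not> adj G a v"
    using blow_up_if_twins[OF assms(2-4)] assms(1) by blast
  have ab: "col G b = col G a"
    using a(2) b(2) by (metis color.exhaust)
  \<comment> \<open>Take \<open>u\<close> or \<open>v\<close> according to whether \<open>b\<close>
    is adjacent to \<open>r\<close>, so that the pair \<open>a\<close>, \<open>w\<close> can be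
    moved to \<open>b\<close>, \<open>r\<close>.\<close>
  obtain w where w: "w \<in> verts G" "w \<in> block u" "adj G a w \<longleftrightarrow> adj G b r"
    using uv a adj_verts by (cases "adj G b r") (auto simp: block_def)
  obtain g where g: "is_iso g G G" "g a = b" "g w = r"
    using move_pair[of a w b r] a ab b r w col_block[OF w(2)] uv by metis
  obtain x where x: "x \<in> block w" "adj G a x \<longleftrightarrow> P"
    using block_eq[OF w(2)] uv a adj_verts by (cases P) (auto simp: block_def)
  have "g x \<in> block r"
    using automorphism_block[OF g(1) w(1)] g(3) x(1) by blast
  moreover have "adj G b (g x) \<longleftrightarrow> P"
    using automorphism_adj[OF g(1) a(1), of x] g(2) x block_subset by auto
  ultimately show ?thesis
    by blast
qed

text \<open>If one of the two traces of \<open>b\<close> on a block were finite, an automorphism fixing the trace in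
  one block and exchanging a single vertex \<open>x\<close> of the trace in another block for \<open>y\<close> would move
  \<open>b\<close> to a vertex \<open>b'\<close> that agrees with \<open>b\<close> on the first block and on some \<open>z\<close> of the second,
  but not on \<open>x\<close>. Moving \<open>z\<close> into the first block while fixing \<open>b\<close> and \<open>b'\<close> is then impossible.\<close>

lemma infinite_trace_on_block:
  assumes r: "r \<in> verts G" and r': "r' \<in> verts G" "col G r' = col G r" "block r' \<noteq> block r"
    and b: "b \<in> verts G" "col G b \<noteq> col G r"
    and mixed: "\<And>s Q. s \<in> {r, r'} \<Longrightarrow> \<exists>u \<in> block s. adj G b u \<longleftrightarrow> Q"
    and three: "\<And>x y. \<not> block r' \<subseteq> {x, y}"
  shows "infinite {u \<in> block r. adj G b u \<longleftrightarrow> P}"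
proof
  define F where "F = {u \<in> block r. adj G b u \<longleftrightarrow> P}"
  define F' where "F' = {u \<in> block r'. adj G b u \<longleftrightarrow> P}"
  assume "finite {u \<in> block r. adj G b u \<longleftrightarrow> P}"
  then have "finite F"
    by (simp add: F_def)
  obtain p where p: "p \<in> F"
    using mixed[of r P] by (auto simp: F_def)
  obtain x where x: "x \<in> F'"
    using mixed[of r' P] by (auto simp: F'_def)
  obtain y where y: "y \<in> block r'" "adj G b y \<longleftrightarrow> \<not> P"
    using mixed[of r' "\<not> P"] by auto
  have disj: "block r \<inter> block r' = {}"
    using block_eq r'(3) by blast
  have sub: "F \<subseteq> block r" "F' \<subseteq> block r'"
    by (auto simp: F_def F'_def)
  have blocks: "v \<in> block r \<Longrightarrow> v \<in> verts G \<and> col G v = col G r"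
    "v \<in> block r' \<Longrightarrow> v \<in> verts G \<and> col G v = col G r" for v
    using block_subset col_block r'(2) by (metis subsetD)+
  have px: "p \<in> block r" "x \<in> block r'" "adj G b p \<longleftrightarrow> P" "adj G b x \<longleftrightarrow> P"
    using p x by (auto simp: F_def F'_def)
  \<comment> \<open>An automorphism that fixes \<open>b\<close> and sends \<open>p\<close> to
    \<open>x\<close> maps \<open>block r\<close> onto \<open>block r'\<close> and hence the first
    trace onto the second.\<close>
  have "finite F'"
  proof -
    obtain h where h: "is_iso h G G" "h b = b" "h p = x"
      using move_pair[of b p b x] b blocks(1)[OF px(1)] blocks(2)[OF px(2)] px(3,4) by metis
    have hr: "h ` block r = block r'"
      using automorphism_block[OF h(1), of p] blocks(1)[OF px(1)]
        block_eq[OF px(1)] block_eq[OF px(2)] h(3) by simp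
    have "F' \<subseteq> h ` F"
    proof
      fix v assume v: "v \<in> F'"
      then obtain u where u: "u \<in> block r" "v = h u"
        using hr sub by blast
      then have "u \<in> F"
        using automorphism_adj[OF h(1) b(1), of u] h(2) v blocks by (auto simp: F_def F'_def)
      then show "v \<in> h ` F"
        using u by blast
    qed
    then show ?thesis
      using \<open>finite F\<close> finite_surj by blast
  qed
  \<comment> \<open>Moving \<open>x\<close> to \<open>y\<close> leaves every vertex in its block,
    and \<open>y\<close> lies outside both traces; so \<open>f\<close> is injective and preserves
    adjacency on the finite set \<open>F \<union> F'\<close>.\<close>
  define f where "f v = (if v = x then y else v)" for v
  have fF: "v \<in> verts G \<and> col G v = col G r \<and> f v \<in> verts G \<and> col G (f v) = col G r \<and>
    block (f v) = block v" if "v \<in> F \<union> F'" for v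
    using that blocks sub y(1) block_eq[OF y(1)] block_eq[OF px(2)] by (auto simp: f_def)
  have y_notin: "y \<notin> F \<union> F'"
    using y disj sub by (auto simp: F'_def)
  have f_inj: "inj_on f (F \<union> F')"
    using y_notin by (auto simp: inj_on_def f_def)
  obtain g where g: "is_iso g G G" and gF: "\<And>v. v \<in> F \<union> F' \<Longrightarrow> g v = f v"
  proof (rule extend_to_automorphism[of "F \<union> F'" f])
    show "adj G (f u) (f v) \<longleftrightarrow> adj G u v" if "u \<in> F \<union> F'" "v \<in> F \<union> F'" "u \<noteq> v" for u v
    proof -
      have "f u \<noteq> f v"
        using inj_onD[OF f_inj _ that(1,2)] that(3) by blast
      then show ?thesis
        using fF[OF that(1)] fF[OF that(2)] that(3)
          adj_iff_block[of u v] adj_iff_block[of "f u" "f v"] by metis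
    qed
    show "F \<union> F' \<subseteq> verts G"
      using fF by blast
    show "f ` (F \<union> F') \<subseteq> verts G"
      by (rule image_subsetI) (use fF in blast)
    show "col G (f v) = col G v" if "v \<in> F \<union> F'" for v
      using fF[OF that] by simp
  qed (use \<open>finite F\<close> \<open>finite F'\<close> f_inj in auto)
  \<comment> \<open>The vertices related to \<open>b'\<close> as prescribed by \<open>P\<close> form
    \<open>F\<close> in \<open>block r\<close>, and in \<open>block r'\<close> they form
    \<open>F'\<close> with \<open>x\<close> replaced by \<open>y\<close>.\<close>
  define b' where "b' = g b"
  have g_eq: "u = v" if "g u = g v" "u \<in> verts G" "v \<in> verts G" for u v
    using inj_onD[OF automorphism_inj[OF g]] that by blast
  have "p \<noteq> x"
    using p x sub disj by blast
  then have "g p = p" "g x = y"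
    using gF p x by (auto simp: f_def)
  then have gr: "g ` block r = block r" and gr': "g ` block r' = block r'"
    using automorphism_block[OF g, of p] automorphism_block[OF g, of x]
      blocks(1)[OF px(1)] blocks(2)[OF px(2)]
      block_eq[OF px(1)] block_eq[OF px(2)] block_eq[OF y(1)] by auto
  \<comment> \<open>Write \<open>u = g w\<close>, so that \<open>b'\<close> sees \<open>u\<close> as
    \<open>b\<close> sees \<open>w\<close>. If one of \<open>u\<close>, \<open>w\<close> lies in
    \<open>F \<union> F'\<close>, they are equal because \<open>g\<close> moves only
    \<open>x\<close> there; otherwise \<open>b\<close> sees both in the way opposite to
    \<open>P\<close>.\<close>
  have agree: "adj G b' u \<longleftrightarrow> adj G b u" if u: "u \<in> block r \<union> block r'" "u \<noteq> x" "u \<noteq> y" for u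
  proof -
    obtain w where w: "w \<in> block r \<union> block r'" "u = g w"
      and uw: "u \<in> F \<union> F' \<longleftrightarrow> (adj G b u \<longleftrightarrow> P)" "w \<in> F \<union> F' \<longleftrightarrow> (adj G b w \<longleftrightarrow> P)"
    proof -
      from u obtain w where "w \<in> block r \<union> block r'" "u = g w"
        using gr gr' by blast
      then show ?thesis
        using that u unfolding F_def F'_def by blast
    qed
    have "w = u" if "w \<in> F \<union> F' \<or> u \<in> F \<union> F'"
      using that gF[of w] gF[of u] w u g_eq[of w u] blocks
      by (auto simp: f_def split: if_splits)
    then have "adj G b u \<longleftrightarrow> adj G b w"
      using uw by blast
    then show ?thesis
      using automorphism_adj[OF g b(1), of w] w blocks by (auto simp: b'_def)
  qed
  have disagree: "adj G b' x \<noteq> adj G b x"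
  proof
    assume same: "adj G b' x = adj G b x"
    obtain w where w: "w \<in> block r'" "x = g w"
      using gr' x sub by blast
    then have "adj G b w \<longleftrightarrow> P"
      using automorphism_adj[OF g b(1), of w] same x blocks by (auto simp: b'_def F'_def)
    then have "w \<in> F'"
      using w by (simp add: F'_def)
    then show False
      using gF[of w] w x y_notin by (auto simp: f_def split: if_splits)
  qed
  \<comment> \<open>At this third vertex \<open>b\<close> and \<open>b'\<close> agree, as they do at
    \<open>w\<close>; hence \<open>z\<close> can be sent to \<open>w\<close> with \<open>b\<close>
    and \<open>b'\<close> fixed.\<close>
  obtain z where z: "z \<in> block r'" "z \<noteq> x" "z \<noteq> y"
    using three[of x y] by blast
  obtain w where w: "w \<in> block r" "adj G b w \<longleftrightarrow> adj G b z"
    using mixed[of r "adj G b z"] by auto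
  have b': "b' \<in> verts G" "col G b' = col G b" "b' \<noteq> b"
    using automorphism_verts[OF g b(1)] automorphism_col[OF g b(1)] disagree
    by (auto simp: b'_def)
  have "w \<noteq> x" "w \<noteq> y"
    using w x y sub disj by blast+
  then have zw: "adj G b' z \<longleftrightarrow> adj G b' w"
    using agree[of z] agree[of w] z w by auto
  have neq: "z \<noteq> b" "z \<noteq> b'" "w \<noteq> b" "w \<noteq> b'"
    using blocks z w b b' by metis+
  obtain h where h: "is_iso h G G" and hv: "\<And>v. v \<in> {b, b', z} \<Longrightarrow> h v = (if v = z then w else v)"
  proof (rule extend_to_automorphism[of "{b, b', z}" "\<lambda>v. if v = z then w else v"])
    show "adj G (if u = z then w else u) (if v = z then w else v) \<longleftrightarrow> adj G u v"
      if "u \<in> {b, b', z}" "v \<in> {b, b', z}" "u \<noteq> v" for u v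
      using that w(2) zw adj_sym neq by (auto split: if_splits)
  qed (use b b' z w blocks neq in \<open>auto simp: inj_on_def\<close>)
  have "h ` block r' = block r"
    using automorphism_block[OF h, of z] hv[of z] blocks(2)[OF z(1)]
      block_eq[OF z(1)] block_eq[OF w(1)] by simp
  then have hx: "h x \<in> block r"
    using x sub by blast
  have "adj G b (h x) \<longleftrightarrow> adj G b x" "adj G b' (h x) \<longleftrightarrow> adj G b' x"
    using automorphism_adj[OF h, of b x] automorphism_adj[OF h, of b' x] hv[of b] hv[of b'] neq
      b b' blocks x sub by auto
  moreover have "h x \<noteq> x" "h x \<noteq> y"
    using hx px(2) y(1) disj by (metis disjoint_iff)+
  ultimately show False
    using agree[of "h x"] hx disagree by auto
qed


section \<open>Prescribed traces and the omission of \<open>D\<close>\<close>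

text \<open>Infinitely many neighbors and non-neighbors of \<open>b\<close> in the block leave room
  for distinct vertices \<open>s k\<close> that already follow the pattern \<open>Q\<close>. An
  automorphism taking \<open>s k\<close> to \<open>t k\<close> for \<open>k \<le> n\<close> then
  takes \<open>b\<close> to the required vertex; the bound \<open>n\<close> keeps its prescribed
  part finite.\<close>

lemma ex_prescribed_trace:
  fixes t :: "nat \<Rightarrow> 'a"
  assumes b: "b \<in> verts G"
    and inf: "\<And>P. infinite {u \<in> block r. adj G b u \<longleftrightarrow> P}"
    and t: "inj t" "range t \<subseteq> block r"
  shows "\<exists>b' \<in> verts G. col G b' = col G b \<and> (\<forall>k \<le> n. adj G b' (t k) \<longleftrightarrow> Q k)"
proof -
  obtain u :: "bool \<Rightarrow> nat \<Rightarrow> 'a"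
    where u: "\<And>P. inj (u P)" "\<And>P k. u P k \<in> {v \<in> block r. adj G b v \<longleftrightarrow> P}"
  proof -
    have "\<forall>P. \<exists>f :: nat \<Rightarrow> 'a. inj f \<and> range f \<subseteq> {v \<in> block r. adj G b v \<longleftrightarrow> P}"
      using infinite_countable_subset[OF inf] by blast
    then obtain u :: "bool \<Rightarrow> nat \<Rightarrow> 'a"
      where "\<forall>P. inj (u P) \<and> range (u P) \<subseteq> {v \<in> block r. adj G b v \<longleftrightarrow> P}"
      by (rule choice[THEN exE])
    then show ?thesis
      using that[of u] by (simp add: image_subset_iff)
  qed
  define s where "s k = u (Q k) k" for k
  have s: "s k \<in> block r" "adj G b (s k) \<longleftrightarrow> Q k" for k
    using u(2) by (auto simp: s_def)
  have s_inj: "inj s"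
  proof (rule injI)
    fix j k assume "s j = s k"
    moreover from this have "Q j = Q k"
      using s(2)[of j] s(2)[of k] by simp
    ultimately show "j = k"
      using injD[OF u(1)[of "Q k"], of j k] by (simp add: s_def)
  qed
  have ts: "t (inv s (s k)) = t k" for k
    using s_inj by simp
  obtain g where g: "is_iso g G G" "\<And>v. v \<in> s ` {..n} \<Longrightarrow> g v = t (inv s v)"
  proof (rule extend_block_injection[of "s ` {..n}" r "\<lambda>v. t (inv s v)"])
    show "inj_on (\<lambda>v. t (inv s v)) (s ` {..n})"
      using t(1) s_inj by (intro inj_onI) (auto simp: inj_eq)
    show "s ` {..n} \<subseteq> block r" "(\<lambda>v. t (inv s v)) ` s ` {..n} \<subseteq> block r"
      using s(1) t(2) by blast+
  qed auto
  have "adj G (g b) (t k) \<longleftrightarrow> Q k" if "k \<le> n" for k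
    using automorphism_adj[OF g(1) b, of "s k"] g(2)[of "s k"] that s block_subset ts by auto
  then show ?thesis
    using automorphism_verts[OF g(1) b] automorphism_col[OF g(1) b] by blast
qed

text \<open>\<open>D\<close> is a complete graph on two red and two blue vertices minus one red-blue
  edge. Thus if two adjacent blue vertices have a common neighbor in a red block, their
  neighborhoods in this block coincide.\<close>

lemma adj_if_omits_D:
  assumes "omits G D_graph"
    and "adj G r1 r2" "adj G b1 b2" "adj G r1 b1" "adj G r1 b2" "adj G r2 b1"
    and "col G r1 = Red" "col G r2 = Red" "col G b1 = Blue" "col G b2 = Blue"
  shows "adj G r2 b2"
proof (rule ccontr)
  assume no: "\<not> adj G r2 b2"
  let ?S = "{r1, r2, b1, b2}"
  let ?f = "\<lambda>v. if v = r1 then D_r1 else if v = r2 then D_r2 else if v = b1 then D_b1 else D_b2"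
  have neq: "r1 \<noteq> r2" "b1 \<noteq> b2" "r1 \<noteq> b1" "r1 \<noteq> b2" "r2 \<noteq> b1" "r2 \<noteq> b2"
    using assms adj_neq by auto
  have sym: "adj G r2 r1" "adj G b2 b1" "adj G b1 r1" "adj G b2 r1" "adj G b1 r2" "\<not> adj G b2 r2"
    using assms no adj_sym by blast+
  have irrefl: "\<not> adj G v v" for v
    using adj_neq by blast
  have "bij_betw ?f ?S UNIV"
  proof -
    have "x \<in> ?f ` ?S" for x
      using neq by (cases x) auto
    moreover have "inj_on ?f ?S"
      using neq by (auto simp: inj_on_def)
    ultimately show ?thesis
      by (auto simp: bij_betw_def)
  qed
  then have "is_iso ?f (induced G ?S) D_graph"
    using neq assms(2-) sym no irrefl
    by (simp add: is_iso_def induced_def D_graph_def doubleton_eq_iff)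
  moreover have "?S \<subseteq> verts G"
    using assms adj_verts by auto
  ultimately show False
    using assms(1) by (auto simp: omits_def isomorphic_def)
qed

lemma infinite_blue_independence_number:
  assumes omits: "omits G D_graph"
    and r: "col G r = Red" and b: "b \<in> verts G" "col G b = Blue"
    and inf: "\<And>P. infinite {u \<in> block r. adj G b u \<longleftrightarrow> P}"
  shows "color_alpha Blue G = \<infinity>"
proof -
  have "infinite (block r)"
    using inf[of True] finite_subset[of "{u \<in> block r. adj G b u \<longleftrightarrow> True}"] by auto
  then obtain t :: "nat \<Rightarrow> 'a" where t: "inj t" "range t \<subseteq> block r"
    using infinite_countable_subset by blast
  have tk: "t k \<in> verts G" "col G (t k) = Red" "block (t k) = block r" for k
    using t(2) block_subset col_block block_eq r by (metis range_subsetD subsetD)+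
  have large: "enat (Suc n) \<le> color_alpha Blue G" for n
  proof -
    \<comment> \<open>The vertices \<open>a i\<close> share the neighbor \<open>t 0\<close> but have strictly increasing traces on
      \<open>t 0, \<dots>, t n\<close>, so two adjacent ones would form \<open>D\<close>.\<close>
    have "\<exists>a \<in> verts G. col G a = Blue \<and> (\<forall>k \<le> n. adj G a (t k) \<longleftrightarrow> k \<le> i)" for i
      using ex_prescribed_trace[OF b(1) inf t, of n "\<lambda>k. k \<le> i"] b(2) by simp
    then obtain a where a: "\<And>i. a i \<in> verts G" "\<And>i. col G (a i) = Blue"
      "\<And>i k. k \<le> n \<Longrightarrow> adj G (a i) (t k) \<longleftrightarrow> k \<le> i"
      by metis
    have less: "a i \<noteq> a j \<and> \<not> adj G (a j) (a i)" if "i < j" "j \<le> n" for i j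
    proof
      show "a i \<noteq> a j"
        using a(3)[of j i] a(3)[of j j] that by auto
      have "t 0 \<noteq> t j"
        using t(1) that by (auto dest: injD)
      then have "adj G (t 0) (t j)"
        using adj_iff_block[of "t 0" "t j"] tk by auto
      \<comment> \<open>If \<open>a j\<close> and \<open>a i\<close> were adjacent, their common
        neighbor \<open>t 0\<close> would force \<open>t j\<close>, a neighbor of
        \<open>a j\<close>, to be adjacent to \<open>a i\<close> as well, contrary to
        \<open>i < j\<close>.\<close>
      then show "\<not> adj G (a j) (a i)"
        using adj_if_omits_D[OF omits, of "t 0" "t j" "a j" "a i"] a tk adj_sym that
        by (metis le0 le_refl leD)
    qed
    have "inj_on a {..n}"
      using less by (intro linorder_inj_onI) auto
    then have "ecard (a ` {..n}) = enat (Suc n)"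
      by (simp add: ecard_def card_image)
    moreover have "\<not> adj G (a i) (a j)" if "i \<le> n" "j \<le> n" for i j
      using less[of i j] less[of j i] that adj_sym adj_neq by (metis linorder_neqE_nat)
    then have "indep_set (induced G (color_class Blue G)) (a ` {..n})"
      using a by (auto simp: indep_set_def induced_def color_class_def)
    ultimately show ?thesis
      unfolding color_alpha_def independence_number_def by (metis SUP_upper mem_Collect_eq)
  qed
  show ?thesis
  proof (cases "color_alpha Blue G")
    case (enat m)
    then show ?thesis
      using large[of m] by simp
  qed simp
qed

section \<open>Independence numbers and maximal cliques in terms of blocks\<close>

lemma ex_nonadjacent:
  assumes "2 \<le> color_alpha c G"
  shows "\<exists>u \<in> color_class c G. \<exists>v \<in> color_class c G. u \<noteq> v \<and> \<not> adj G u v"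
proof (rule ccontr)
  assume no: "\<not> ?thesis"
  have "ecard K \<le> 1" if "indep_set (induced G (color_class c G)) K" for K
  proof -
    have "u = v" if "u \<in> K" "v \<in> K" for u v
      using no that \<open>indep_set _ K\<close> unfolding indep_set_def induced_def
      by simp (metis subsetD)
    then obtain x where "K \<subseteq> {x}"
      by blast
    then show ?thesis
      using ecard_mono[of K "{x}"] by (simp add: ecard_def one_enat_def)
  qed
  then have "color_alpha c G \<le> 1"
    unfolding color_alpha_def independence_number_def by (auto intro: SUP_least)
  then have "2 \<le> (1 :: enat)"
    using assms by (rule order_trans[rotated])
  then show False
    by (simp add: numeral_eq_enat one_enat_def)
qed

lemma clique_subset_block:
  assumes "is_clique (induced G (color_class c G)) K" "r \<in> K"
  shows "K \<subseteq> block r"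
  using assms by (auto simp: is_clique_def induced_def color_class_def block_def)

lemma is_clique_block:
  assumes "r \<in> color_class c G"
  shows "is_clique (induced G (color_class c G)) (block r)"
proof -
  have "u \<in> color_class c G" if "u \<in> block r" for u
    using assms that by (auto simp: color_class_def block_def)
  then show ?thesis
    using adj_in_block by (auto simp: is_clique_def induced_def)
qed

text \<open>A clique is contained in the block of any of its vertices, and this block is itself a
  clique. That the color class is nonempty excludes the empty set as a maximal clique.\<close>

lemma maximal_clique_is_block:
  assumes "maximal_clique (induced G (color_class c G)) M" and ne: "color_class c G \<noteq> {}"
  shows "\<exists>r \<in> color_class c G. M = block r"
proof -
  have M: "is_clique (induced G (color_class c G)) M"
    and max: "\<And>L. is_clique (induced G (color_class c G)) L \<Longrightarrow> M \<subseteq> L \<Longrightarrow> L = M"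
    using assms(1) by (auto simp: maximal_clique_def)
  have "M \<noteq> {}"
  proof
    assume "M = {}"
    obtain r where r: "r \<in> color_class c G"
      using ne by blast
    then show False
      using max[OF is_clique_block[OF r]] \<open>M = {}\<close> self_mem_block[of r]
      by (auto simp: color_class_def)
  qed
  then obtain r where "r \<in> M"
    by blast
  moreover from this have "r \<in> color_class c G"
    using M by (auto simp: is_clique_def induced_def)
  ultimately show ?thesis
    using max[OF is_clique_block] clique_subset_block[OF M] by metis
qed

section \<open>The dichotomy for red cliques\<close>

text \<open>Provides the premises of \<open>infinite_trace_on_block\<close>: red blocks are
  equicardinal, so all have at least three vertices; a second red block exists since the red
  independence number is at least 2; and \<open>G\<close> is not a blow-up, so every trace is
  mixed.\<close>

lemma infinite_traces_if_three_clique: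
  assumes "basic G" and K: "is_clique (induced G (color_class Red G)) K" "\<not> ecard K \<le> 2"
    and r: "r \<in> color_class Red G" and b: "b \<in> color_class Blue G"
  shows "infinite {u \<in> block r. adj G b u \<longleftrightarrow> P}"
proof -
  obtain q where q: "q \<in> K"
    using K(2) by (force simp: ecard_def zero_enat_def[symmetric])
  then have "q \<in> color_class Red G"
    using K(1) by (auto simp: is_clique_def induced_def)
  then have big: "\<not> ecard (block s) \<le> 2" if "s \<in> color_class Red G" for s
    using block_equicardinal[of q s] that ecard_mono[OF clique_subset_block[OF K(1) q]] K(2)
    by (auto simp: color_class_def)
  have three: "\<not> block s \<subseteq> {x, y}" if "s \<in> color_class Red G" for s x y
  proof
    assume "block s \<subseteq> {x, y}"
    then have "ecard (block s) \<le> ecard {x, y}"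
      by (rule ecard_mono)
    also have "\<dots> \<le> 2"
      by (simp add: ecard_def numeral_eq_enat card_insert_if)
    finally show False
      using big[OF that] by blast
  qed
  obtain v where v: "v \<in> block r" "v \<noteq> r"
    using three[OF r, of r r] by blast
  have red: "r \<in> verts G" "col G r = Red" and blue: "b \<in> verts G" "col G b = Blue"
    using r b by (auto simp: color_class_def)
  have mixed: "\<exists>u \<in> block s. adj G b u \<longleftrightarrow> Q" if "s \<in> color_class Red G" for s Q
    using neighbor_and_non_neighbor_in_block[of r v Red s b Q] assms(1) that v red blue
    by (auto simp: color_class_def block_def basic_def)
  obtain x y where xy: "x \<in> color_class Red G" "y \<in> color_class Red G" "x \<noteq> y" "\<not> adj G x y"
    using ex_nonadjacent[of Red] assms(1) by (auto simp: basic_def)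
  then have "block x \<noteq> block y"
    using adj_iff_block[of x y] by (auto simp: color_class_def)
  then obtain r' where r': "r' \<in> color_class Red G" "block r' \<noteq> block r"
    using xy by metis
  show ?thesis
  proof (rule infinite_trace_on_block[of r r'])
    show "\<exists>u \<in> block s. adj G b u \<longleftrightarrow> Q" if "s \<in> {r, r'}" for s Q
      using mixed that r r' by blast
  qed (use three[OF r'(1)] r' red blue in \<open>auto simp: color_class_def\<close>)
qed

end

theorem theorem5p8:
  fixes G :: "'a cgraph"
  assumes "CUH G" and "basic G"
    and "omits G D_graph"
    and "\<not> indep_set G (color_class Red G) \<or> \<not> indep_set G (color_class Blue G)"
  shows "color_omega Red G \<in> {1, 2, \<infinity>} \<and>
    (color_omega Red G = \<infinity> \<longrightarrow>
       color_alpha Blue G = \<infinity> \<and>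
       (\<forall>b M. b \<in> color_class Blue G \<and>
              maximal_clique (induced G (color_class Red G)) M \<longrightarrow>
          ecard (nbrs G b \<inter> M) = \<infinity> \<and> ecard (M - nbrs G b) = \<infinity>))"
proof -
  interpret CUH_graph G
    using assms(1) by unfold_locales
  let ?R = "induced G (color_class Red G)"
  have "2 \<le> color_alpha Red G" "2 \<le> color_alpha Blue G"
    using assms(2) by (auto simp: basic_def)
  then obtain r b where r: "r \<in> color_class Red G" and b: "b \<in> color_class Blue G"
    using ex_nonadjacent by metis
  have omega_ge: "ecard K \<le> color_omega Red G" if "is_clique ?R K" for K
    unfolding color_omega_def clique_number_def using that by (auto intro: SUP_upper)
  have small: "color_omega Red G \<in> {1, 2}" if "\<And>K. is_clique ?R K \<Longrightarrow> ecard K \<le> 2"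
  proof -
    have "color_omega Red G \<le> 2"
      unfolding color_omega_def clique_number_def using that by (auto intro: SUP_least)
    moreover have "is_clique ?R {r}"
      using r by (auto simp: is_clique_def induced_def)
    then have "1 \<le> color_omega Red G"
      using omega_ge[of "{r}"] by (simp add: ecard_def one_enat_def)
    ultimately show ?thesis
      by (cases "color_omega Red G") (auto simp: one_enat_def numeral_eq_enat)
  qed
  \<comment> \<open>If no red clique exceeds two vertices, \<open>color_omega Red G\<close> is
    finite and the second claim is vacuous; otherwise all traces on red blocks are infinite, which
    gives every assertion.\<close>
  show ?thesis
  proof (cases "\<forall>K. is_clique ?R K \<longrightarrow> ecard K \<le> 2")
    case True
    then show ?thesis
      using small by (auto simp: numeral_eq_enat one_enat_def)
  next
    case False
    then have traces: "infinite {u \<in> block s. adj G a u \<longleftrightarrow> P}"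
      if "s \<in> color_class Red G" "a \<in> color_class Blue G" for s a P
      using infinite_traces_if_three_clique[OF assms(2)] that by blast
    have "infinite (block r)"
      using traces[OF r b, of True] finite_subset[of "{u \<in> block r. adj G b u \<longleftrightarrow> True}"] by auto
    then have "color_omega Red G = \<infinity>"
      using omega_ge[OF is_clique_block[OF r]] by (simp add: ecard_def)
    moreover have "color_alpha Blue G = \<infinity>"
      using infinite_blue_independence_number[OF assms(3), of r b] traces[OF r b] r b
      by (auto simp: color_class_def)
    moreover have "ecard (nbrs G a \<inter> M) = \<infinity> \<and> ecard (M - nbrs G a) = \<infinity>"
      if a: "a \<in> color_class Blue G" and M: "maximal_clique ?R M" for a M
    proof -
      obtain s where s: "s \<in> color_class Red G" "M = block s"
        using maximal_clique_is_block[OF M] r by blast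
      have "nbrs G a \<inter> M = {u \<in> block s. adj G a u}" "M - nbrs G a = {u \<in> block s. \<not> adj G a u}"
        using s block_subset by (auto simp: nbrs_def)
      then show ?thesis
        using traces[OF s(1) a, of True] traces[OF s(1) a, of False] by (simp add: ecard_def)
    qed
    ultimately show ?thesis
      by blast
  qed
qed

end
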